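(* Let $D$ be any Dedekind domain, let $S$ be any nonempty subset of $D$, and let $\mathfrak{b}$ be any ideal of $D$ (including $\mathfrak{b}=(0)$ and $\mathfrak{b}=(1)$). Then the following hold. (1) For each fixed $r\in\mathbb{N}$, the $r$-removed $\mathfrak{b}$-exponent sequence $\{\alpha_k^{\{r\}}(S,\mathfrak{b},\mathbf{a}):k\ge 0\}$ of an $r$-removed $\mathfrak{b}$-ordering $\mathbf{a}$ of $S$ is independent of the $r$-removed $\mathfrak{b}$-ordering $\mathbf{a}$ of $S$ chosen; thus it gives well-defined invariants $\alpha_k^{\{r\}}(S,\mathfrak{b})$ for each $k\ge 0$. (2) For each fixed $h\in\mathbb{N}\cup\{+\infty\}$, the order $h$ $\mathfrak{b}$-exponent sequence $\{\alpha_k^{h}(S,\mathfrak{b},\mathbf{a}):k\ge 0\}$ of a $\mathfrak{b}$-ordering $\mathbf{a}$ of order $h$ of $S$ is independent of the $\mathfrak{b}$-ordering $\mathbf{a}$ of order $h$ of $S$ chosen; thus it gives well-defined invariants $\alpha_k^{h}(S,\mathfrak{b})$ for each $k\ge 0$. (3) For each fixed $h\in\mathbb{N}\cup\{+\infty\}$ and $r\in\mathbb{N}$, the order $h$, $r$-removed $\mathfrak{b}$-exponent sequence $\{\alpha_k^{h,\{r\}}(S,\mathfrak{b},\mathbf{a}):k\ge 0\}$ of an $r$-removed $\mathfrak{b}$-ordering $\mathbf{a}$ of order $h$ of $S$ is independent of the $r$-removed $\mathfrak{b}$-ordering $\mathbf{a}$ of order $h$ of $S$ chosen; thus it gives well-defined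 invariants $\alpha_k^{h,\{r\}}(S,\mathfrak{b})$ for each $k\ge 0$.
   Context: $\mathbb{N}=\{0,1,2,\dots\}$. For an ideal $\mathfrak{b}$ of $D$, with $\mathfrak{b}^0=D$, put $v_{\mathfrak{b}}(a)=\sup\{k\in\mathbb{N}: aD\subseteq\mathfrak{b}^k\}\in\mathbb{N}\cup\{+\infty\}$ for $a\in D$. For a sequence $\mathbf{a}=(a_i)_{i=0}^\infty$ of elements of $S$ (repetitions allowed), $h\in\mathbb{N}\cup\{+\infty\}$ and $r\in\mathbb{N}$, define $$\alpha_n^{h,\{r\}}(S,\mathfrak{b},\mathbf{a})=\min_{A}\sum_{i\in A}\min\bigl(h,v_{\mathfrak{b}}(a_n-a_i)\bigr),$$ where $A$ ranges over all subsets of $\{0,1,\dots,n-1\}$ of cardinality $\max(n-r,0)$ (so the value is $0$ for $0\le n\le r$). The sequence $\mathbf{a}$ is an $r$-removed $\mathfrak{b}$-ordering of order $h$ of $S$ if $a_0,\dots,a_r\in S$ are arbitrary and, for every $n>r$, $a_n$ attains the minimum over $s\in S$ of $$\min_{A}\sum_{i\in A}\min\bigl(h,v_{\mathfrak{b}}(s-a_i)\bigr),$$ $A$ ranging over all subsets of $\{0,\dots,n-1\}$ of cardinality $n-r$. An $r$-removed $\mathfrak{b}$-ordering is the case $h=+\infty$, with $\alpha_n^{\{r\}}=\alpha_n^{+\infty,\{r\}}$; a $\mathfrak{b}$-ordering of order $h$ is the case $r=0$, with $\alpha_n^{h}=\alpha_n^{h,\{0\}}$, i.e. $\alpha_n^h(S,\mathfrak{b},\mathbf{a})=\sum_{i=0}^{n-1}\min(h,v_{\mathfrak{b}}(a_n-a_i))$.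 *)

theory Defs
  imports
    "HOL-Algebra.Ring_Divisibility"
    "HOL-Algebra.Ideal_Product"
    "HOL-Algebra.Polynomials"
    "HOL-Library.Extended_Nat"
begin

section \<open>Field of fractions of a domain\<close>

definition fract_pairs :: "('a, 'm) ring_scheme \<Rightarrow> ('a \<times> 'a) set"
  where "fract_pairs D = carrier D \<times> (carrier D - {\<zero>\<^bsub>D\<^esub>})"

definition fract_rel :: "('a, 'm) ring_scheme \<Rightarrow> (('a \<times> 'a) \<times> ('a \<times> 'a)) set"
  where "fract_rel D = {((a, b), (c, d)). (a, b) \<in> fract_pairs D \<and> (c, d) \<in> fract_pairs D
                          \<and> a \<otimes>\<^bsub>D\<^esub> d = c \<otimes>\<^bsub>D\<^esub> b}"

definition fract :: "('a, 'm) ring_scheme \<Rightarrow> 'a \<Rightarrow> 'a \<Rightarrow> ('a \<times> 'a) set"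
  where "fract D a b = fract_rel D `` {(a, b)}"

text \<open>The unions over representatives are constant families; see \<open>fract_add\<close> and
  \<open>fract_mult\<close> below for the resulting rules.\<close>

definition fraction_field :: "('a, 'm) ring_scheme \<Rightarrow> ('a \<times> 'a) set ring"
  where "fraction_field D =
    \<lparr> carrier = fract_pairs D // fract_rel D,
      monoid.mult = (\<lambda>U V. \<Union>(a, b)\<in>U. \<Union>(c, d)\<in>V. fract D (a \<otimes>\<^bsub>D\<^esub> c) (b \<otimes>\<^bsub>D\<^esub> d)),
      one = fract D \<one>\<^bsub>D\<^esub> \<one>\<^bsub>D\<^esub>,
      zero = fract D \<zero>\<^bsub>D\<^esub> \<one>\<^bsub>D\<^esub>,
      add = (\<lambda>U V. \<Union>(a, b)\<in>U. \<Union>(c, d)\<in>V.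
               fract D (a \<otimes>\<^bsub>D\<^esub> d \<oplus>\<^bsub>D\<^esub> c \<otimes>\<^bsub>D\<^esub> b) (b \<otimes>\<^bsub>D\<^esub> d)) \<rparr>"

context "domain"
begin

lemma fract_pairs_iff: "(a, b) \<in> fract_pairs R \<longleftrightarrow> a \<in> carrier R \<and> b \<in> carrier R \<and> b \<noteq> \<zero>"
  by (auto simp: fract_pairs_def)

lemma fract_rel_iff:
  "((a, b), (c, d)) \<in> fract_rel R \<longleftrightarrow>
     a \<in> carrier R \<and> b \<in> carrier R \<and> b \<noteq> \<zero> \<and> c \<in> carrier R \<and> d \<in> carrier R \<and> d \<noteq> \<zero>
     \<and> a \<otimes> d = c \<otimes> b"
  by (auto simp: fract_rel_def fract_pairs_iff)

lemma equiv_fract_rel: "equiv (fract_pairs R) (fract_rel R)"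
proof (intro equivI)
  show "fract_rel R \<subseteq> fract_pairs R \<times> fract_pairs R"
    by (auto simp: fract_rel_def)
  show "refl_on (fract_pairs R) (fract_rel R)"
    by (auto simp: refl_on_def fract_rel_def)
  show "sym (fract_rel R)"
    by (auto simp: sym_def fract_rel_def)
  show "trans (fract_rel R)"
  proof (rule transI, clarify)
    fix a b c d e f
    assume 1: "((a, b), (c, d)) \<in> fract_rel R" and 2: "((c, d), (e, f)) \<in> fract_rel R"
    have carr: "a \<in> carrier R" "b \<in> carrier R" "c \<in> carrier R" "d \<in> carrier R"
        "e \<in> carrier R" "f \<in> carrier R" and nz: "b \<noteq> \<zero>" "d \<noteq> \<zero>" "f \<noteq> \<zero>"
      and eq: "a \<otimes> d = c \<otimes> b" "c \<otimes> f = e \<otimes> d"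
      using 1 2 by (auto simp: fract_rel_iff)
    have "d \<otimes> (a \<otimes> f) = (a \<otimes> d) \<otimes> f" using carr by (simp add: m_ac)
    also have "\<dots> = (c \<otimes> f) \<otimes> b" using carr eq(1) by (simp add: m_ac)
    also have "\<dots> = d \<otimes> (e \<otimes> b)" using carr eq(2) by (simp add: m_ac)
    finally have "a \<otimes> f = e \<otimes> b"
      using m_lcancel[OF nz(2) carr(4)] carr by auto
    then show "((a, b), (e, f)) \<in> fract_rel R"
      using carr nz by (simp add: fract_rel_iff)
  qed
qed

lemma fract_eq_iff:
  assumes "a \<in> carrier R" "b \<in> carrier R" "b \<noteq> \<zero>" "c \<in> carrier R" "d \<in> carrier R" "d \<noteq> \<zero>"
  shows "fract R a b = fract R c d \<longleftrightarrow> a \<otimes> d = c \<otimes> b"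
  using eq_equiv_class_iff[OF equiv_fract_rel, of "(a, b)" "(c, d)"] assms
  by (simp add: fract_def fract_pairs_iff fract_rel_iff)

lemma fract_memI:
  assumes "a \<in> carrier R" "b \<in> carrier R" "b \<noteq> \<zero>"
  shows "(a, b) \<in> fract R a b"
  using assms by (auto simp: fract_def fract_rel_iff)

lemma fract_memD:
  assumes "(c, d) \<in> fract R a b"
  shows "c \<in> carrier R" "d \<in> carrier R" "d \<noteq> \<zero>" "a \<otimes> d = c \<otimes> b"
  using assms by (auto simp: fract_def fract_rel_iff)

lemma fraction_field_carrier:
  "carrier (fraction_field R) = {fract R a b | a b. a \<in> carrier R \<and> b \<in> carrier R \<and> b \<noteq> \<zero>}"
  unfolding fraction_field_def quotient_def fract_def fract_pairs_def by (simp, blast)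

lemma fract_mult:
  assumes "a \<in> carrier R" "b \<in> carrier R" "b \<noteq> \<zero>" "c \<in> carrier R" "d \<in> carrier R" "d \<noteq> \<zero>"
  shows "fract R a b \<otimes>\<^bsub>fraction_field R\<^esub> fract R c d = fract R (a \<otimes> c) (b \<otimes> d)"
proof -
  have "fract R (a' \<otimes> c') (b' \<otimes> d') = fract R (a \<otimes> c) (b \<otimes> d)"
    if "(a', b') \<in> fract R a b" "(c', d') \<in> fract R c d" for a' b' c' d'
  proof -
    note eqs = fract_memD(4)[OF that(1)] fract_memD(4)[OF that(2)]
    note * = fract_memD(1-3)[OF that(1)] fract_memD(1-3)[OF that(2)]
    have "(a' \<otimes> c') \<otimes> (b \<otimes> d) = (a' \<otimes> b) \<otimes> (c' \<otimes> d)" using * assms by (simp add: m_ac)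
    also have "\<dots> = (a \<otimes> b') \<otimes> (c \<otimes> d')" by (simp only: eqs)
    also have "\<dots> = (a \<otimes> c) \<otimes> (b' \<otimes> d')" using * assms by (simp add: m_ac)
    finally show ?thesis
      using * assms by (subst fract_eq_iff) (auto simp: integral_iff)
  qed
  then have "(\<Union>(a', b')\<in>fract R a b. \<Union>(c', d')\<in>fract R c d. fract R (a' \<otimes> c') (b' \<otimes> d'))
      = (\<Union>p\<in>fract R a b. \<Union>q\<in>fract R c d. fract R (a \<otimes> c) (b \<otimes> d))"
    by (intro SUP_cong refl, clarify, intro SUP_cong refl, clarify)
  also have "\<dots> = fract R (a \<otimes> c) (b \<otimes> d)"
    using fract_memI[of a b] fract_memI[of c d] assms by auto
  finally show ?thesis
    by (simp add: fraction_field_def)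
qed

lemma fract_add:
  assumes "a \<in> carrier R" "b \<in> carrier R" "b \<noteq> \<zero>" "c \<in> carrier R" "d \<in> carrier R" "d \<noteq> \<zero>"
  shows "fract R a b \<oplus>\<^bsub>fraction_field R\<^esub> fract R c d
           = fract R (a \<otimes> d \<oplus> c \<otimes> b) (b \<otimes> d)"
proof -
  have "fract R (a' \<otimes> d' \<oplus> c' \<otimes> b') (b' \<otimes> d') = fract R (a \<otimes> d \<oplus> c \<otimes> b) (b \<otimes> d)"
    if "(a', b') \<in> fract R a b" "(c', d') \<in> fract R c d" for a' b' c' d'
  proof -
    note eqs = fract_memD(4)[OF that(1)] fract_memD(4)[OF that(2)]
    note * = fract_memD(1-3)[OF that(1)] fract_memD(1-3)[OF that(2)]
    have "(a' \<otimes> d' \<oplus> c' \<otimes> b') \<otimes> (b \<otimes> d)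
            = (a' \<otimes> d') \<otimes> (b \<otimes> d) \<oplus> (c' \<otimes> b') \<otimes> (b \<otimes> d)"
      using * assms by (simp add: l_distr)
    also have "\<dots> = (a' \<otimes> b) \<otimes> (d \<otimes> d') \<oplus> (c' \<otimes> d) \<otimes> (b \<otimes> b')"
      using * assms by (simp add: m_ac)
    also have "\<dots> = (a \<otimes> b') \<otimes> (d \<otimes> d') \<oplus> (c \<otimes> d') \<otimes> (b \<otimes> b')"
      by (simp only: eqs)
    also have "\<dots> = (a \<otimes> d) \<otimes> (b' \<otimes> d') \<oplus> (c \<otimes> b) \<otimes> (b' \<otimes> d')"
      using * assms by (simp add: m_ac)
    also have "\<dots> = (a \<otimes> d \<oplus> c \<otimes> b) \<otimes> (b' \<otimes> d')"
      using * assms by (simp add: l_distr)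
    finally show ?thesis
      using * assms by (subst fract_eq_iff) (auto simp: integral_iff)
  qed
  then have "(\<Union>(a', b')\<in>fract R a b. \<Union>(c', d')\<in>fract R c d. fract R (a' \<otimes> d' \<oplus> c' \<otimes> b') (b' \<otimes> d'))
      = (\<Union>p\<in>fract R a b. \<Union>q\<in>fract R c d. fract R (a \<otimes> d \<oplus> c \<otimes> b) (b \<otimes> d))"
    by (intro SUP_cong refl, clarify, intro SUP_cong refl, clarify)
  also have "\<dots> = fract R (a \<otimes> d \<oplus> c \<otimes> b) (b \<otimes> d)"
    using fract_memI[of a b] fract_memI[of c d] assms by auto
  finally show ?thesis
    by (simp add: fraction_field_def)
qed

lemma fract_one: "\<one>\<^bsub>fraction_field R\<^esub> = fract R \<one> \<one>"
  and fract_zero: "\<zero>\<^bsub>fraction_field R\<^esub> = fract R \<zero> \<one>"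
  by (simp_all add: fraction_field_def)

lemma fract_in_carrier:
  "a \<in> carrier R \<Longrightarrow> b \<in> carrier R \<Longrightarrow> b \<noteq> \<zero> \<Longrightarrow> fract R a b \<in> carrier (fraction_field R)"
  by (auto simp: fraction_field_carrier)

lemma fract_cases:
  assumes "x \<in> carrier (fraction_field R)"
  obtains a b where "a \<in> carrier R" "b \<in> carrier R" "b \<noteq> \<zero>" "x = fract R a b"
  using assms by (auto simp: fraction_field_carrier)

lemma fraction_field_is_field: "field (fraction_field R)"
proof -
  let ?F = "fraction_field R"
  note fs = fract_mult fract_add fract_one fract_zero integral_iff fract_in_carrier
  interpret F: cring ?F
  proof (rule cringI)
    show "abelian_group ?F"
    proof (rule abelian_groupI)
      fix x y assume carr: "x \<in> carrier ?F" "y \<in> carrier ?F"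
      obtain a b where xx: "a \<in> carrier R" "b \<in> carrier R" "b \<noteq> \<zero>" "x = fract R a b"
        by (rule fract_cases[OF carr(1)])
      obtain c d where yy: "c \<in> carrier R" "d \<in> carrier R" "d \<noteq> \<zero>" "y = fract R c d"
        by (rule fract_cases[OF carr(2)])
      note reps = xx yy
      then show "x \<oplus>\<^bsub>?F\<^esub> y \<in> carrier ?F" "x \<oplus>\<^bsub>?F\<^esub> y = y \<oplus>\<^bsub>?F\<^esub> x"
        by (simp_all add: fs m_comm a_comm)
    next
      show "\<zero>\<^bsub>?F\<^esub> \<in> carrier ?F" by (simp add: fs)
    next
      fix x y z assume carr: "x \<in> carrier ?F" "y \<in> carrier ?F" "z \<in> carrier ?F"
      obtain a b where xx: "a \<in> carrier R" "b \<in> carrier R" "b \<noteq> \<zero>" "x = fract R a b"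
        by (rule fract_cases[OF carr(1)])
      obtain c d where yy: "c \<in> carrier R" "d \<in> carrier R" "d \<noteq> \<zero>" "y = fract R c d"
        by (rule fract_cases[OF carr(2)])
      obtain e f where zz: "e \<in> carrier R" "f \<in> carrier R" "f \<noteq> \<zero>" "z = fract R e f"
        by (rule fract_cases[OF carr(3)])
      note reps = xx yy zz
      moreover from reps have
        "(a \<otimes> d \<oplus> c \<otimes> b) \<otimes> f \<oplus> e \<otimes> (b \<otimes> d) = a \<otimes> (d \<otimes> f) \<oplus> (c \<otimes> f \<oplus> e \<otimes> d) \<otimes> b"
        by algebra
      ultimately show "x \<oplus>\<^bsub>?F\<^esub> y \<oplus>\<^bsub>?F\<^esub> z = x \<oplus>\<^bsub>?F\<^esub> (y \<oplus>\<^bsub>?F\<^esub> z)"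
        by (simp add: fs m_assoc)
    next
      fix x assume carr: "x \<in> carrier ?F"
      obtain a b where x: "a \<in> carrier R" "b \<in> carrier R" "b \<noteq> \<zero>" "x = fract R a b"
        by (rule fract_cases[OF carr(1)])
      then show "\<zero>\<^bsub>?F\<^esub> \<oplus>\<^bsub>?F\<^esub> x = x"
        by (simp add: fs)
      have "fract R (\<ominus> a) b \<oplus>\<^bsub>?F\<^esub> x = \<zero>\<^bsub>?F\<^esub>"
        using x by (simp add: fs fract_eq_iff l_minus l_neg)
      then show "\<exists>y\<in>carrier ?F. y \<oplus>\<^bsub>?F\<^esub> x = \<zero>\<^bsub>?F\<^esub>"
        using x by (intro bexI[of _ "fract R (\<ominus> a) b"]) (auto simp: fs)
    qed
    show "comm_monoid ?F"
    proof (rule comm_monoidI)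
      fix x y assume carr: "x \<in> carrier ?F" "y \<in> carrier ?F"
      obtain a b where xx: "a \<in> carrier R" "b \<in> carrier R" "b \<noteq> \<zero>" "x = fract R a b"
        by (rule fract_cases[OF carr(1)])
      obtain c d where yy: "c \<in> carrier R" "d \<in> carrier R" "d \<noteq> \<zero>" "y = fract R c d"
        by (rule fract_cases[OF carr(2)])
      note reps = xx yy
      then show "x \<otimes>\<^bsub>?F\<^esub> y \<in> carrier ?F" "x \<otimes>\<^bsub>?F\<^esub> y = y \<otimes>\<^bsub>?F\<^esub> x"
        by (simp_all add: fs m_comm)
    next
      show "\<one>\<^bsub>?F\<^esub> \<in> carrier ?F" by (simp add: fs)
    next
      fix x y z assume carr: "x \<in> carrier ?F" "y \<in> carrier ?F" "z \<in> carrier ?F"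
      obtain a b where xx: "a \<in> carrier R" "b \<in> carrier R" "b \<noteq> \<zero>" "x = fract R a b"
        by (rule fract_cases[OF carr(1)])
      obtain c d where yy: "c \<in> carrier R" "d \<in> carrier R" "d \<noteq> \<zero>" "y = fract R c d"
        by (rule fract_cases[OF carr(2)])
      obtain e f where zz: "e \<in> carrier R" "f \<in> carrier R" "f \<noteq> \<zero>" "z = fract R e f"
        by (rule fract_cases[OF carr(3)])
      note reps = xx yy zz
      then show "x \<otimes>\<^bsub>?F\<^esub> y \<otimes>\<^bsub>?F\<^esub> z = x \<otimes>\<^bsub>?F\<^esub> (y \<otimes>\<^bsub>?F\<^esub> z)"
        by (simp add: fs m_ac)
    next
      fix x assume carr: "x \<in> carrier ?F"
      obtain a b where reps: "a \<in> carrier R" "b \<in> carrier R" "b \<noteq> \<zero>" "x = fract R a b"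
        by (rule fract_cases[OF carr(1)])
      then show "\<one>\<^bsub>?F\<^esub> \<otimes>\<^bsub>?F\<^esub> x = x"
        by (simp add: fs)
    qed
    fix x y z assume carr: "x \<in> carrier ?F" "y \<in> carrier ?F" "z \<in> carrier ?F"
    obtain a b where xx: "a \<in> carrier R" "b \<in> carrier R" "b \<noteq> \<zero>" "x = fract R a b"
      by (rule fract_cases[OF carr(1)])
    obtain c d where yy: "c \<in> carrier R" "d \<in> carrier R" "d \<noteq> \<zero>" "y = fract R c d"
      by (rule fract_cases[OF carr(2)])
    obtain e f where zz: "e \<in> carrier R" "f \<in> carrier R" "f \<noteq> \<zero>" "z = fract R e f"
      by (rule fract_cases[OF carr(3)])
    note reps = xx yy zz
    moreover from reps have
      "((a \<otimes> d \<oplus> c \<otimes> b) \<otimes> e) \<otimes> (b \<otimes> f \<otimes> (d \<otimes> f))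
         = (a \<otimes> e \<otimes> (d \<otimes> f) \<oplus> c \<otimes> e \<otimes> (b \<otimes> f)) \<otimes> (b \<otimes> d \<otimes> f)"
      by algebra
    ultimately show "(x \<oplus>\<^bsub>?F\<^esub> y) \<otimes>\<^bsub>?F\<^esub> z = x \<otimes>\<^bsub>?F\<^esub> z \<oplus>\<^bsub>?F\<^esub> y \<otimes>\<^bsub>?F\<^esub> z"
      by (simp add: fs fract_eq_iff)
  qed
  show ?thesis
  proof (rule F.cring_fieldI2)
    show "\<zero>\<^bsub>?F\<^esub> \<noteq> \<one>\<^bsub>?F\<^esub>"
      by (simp add: fs fract_eq_iff)
    fix x assume carr: "x \<in> carrier ?F" "x \<noteq> \<zero>\<^bsub>?F\<^esub>"
    obtain a b where *: "a \<in> carrier R" "b \<in> carrier R" "b \<noteq> \<zero>" "x = fract R a b"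
      by (rule fract_cases[OF carr(1)])
    have "a \<noteq> \<zero>"
      using carr(2) * by (auto simp: fs fract_eq_iff)
    with * have "fract R b a \<in> carrier ?F" "x \<otimes>\<^bsub>?F\<^esub> fract R b a = \<one>\<^bsub>?F\<^esub>"
      by (simp_all add: fs fract_eq_iff m_comm)
    then show "\<exists>y\<in>carrier ?F. x \<otimes>\<^bsub>?F\<^esub> y = \<one>\<^bsub>?F\<^esub>" by blast
  qed
qed

lemma fract_embedding:
  "(\<lambda>a. fract R a \<one>) \<in> ring_hom R (fraction_field R)"
  "inj_on (\<lambda>a. fract R a \<one>) (carrier R)"
  by (auto simp: ring_hom_def inj_on_def fract_in_carrier fract_mult fract_add fract_one fract_eq_iff)

end


section \<open>Dedekind domains\<close>

definition (in ring) integral_over :: "'a set \<Rightarrow> 'a \<Rightarrow> bool"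
  where "integral_over K x \<longleftrightarrow>
    (\<exists>p \<in> carrier (univ_poly R K). p \<noteq> [] \<and> lead_coeff p = \<one> \<and> eval p x = \<zero>)"

definition integrally_closed :: "('a, 'm) ring_scheme \<Rightarrow> bool"
  where "integrally_closed D \<longleftrightarrow>
    (let F = fraction_field D; D' = (\<lambda>a. fract D a \<one>\<^bsub>D\<^esub>) ` carrier D
     in \<forall>x \<in> carrier F. ring.integral_over F D' x \<longrightarrow> x \<in> D')"

text \<open>Fields are admitted as (trivial) Dedekind domains.\<close>

locale dedekind_domain = noetherian_domain D for D (structure) +
  assumes integrally_closed: "integrally_closed D"
    and nonzero_prime_maximal: "\<lbrakk> primeideal P D; P \<noteq> {\<zero>} \<rbrakk> \<Longrightarrow> maximalideal P D"


section \<open>Removed orderings of finite order and their exponent sequences\<close>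

text \<open>The power is taken in the multiplicative monoid of ideals, so the zeroth power of
  every ideal, the zero ideal included, is the whole ring.\<close>

definition ideal_val :: "('a, 'm) ring_scheme \<Rightarrow> 'a set \<Rightarrow> 'a \<Rightarrow> enat"
  where "ideal_val D \<bb> a =
    (SUP k \<in> {k::nat. PIdl\<^bsub>D\<^esub> a \<subseteq> \<bb> [^]\<^bsub>ideals_set D\<^esub> k}. enat k)"

text \<open>The difference \<open>n - r\<close> below is truncated, hence equal to \<open>max (n - r) 0\<close>.\<close>

definition removed_sum ::
    "('a, 'm) ring_scheme \<Rightarrow> 'a set \<Rightarrow> enat \<Rightarrow> nat \<Rightarrow> (nat \<Rightarrow> 'a) \<Rightarrow> nat \<Rightarrow> 'a \<Rightarrow> enat"
  where "removed_sum D \<bb> h r a n s =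
    Min ((\<lambda>A. \<Sum>i\<in>A. min h (ideal_val D \<bb> (s \<ominus>\<^bsub>D\<^esub> a i))) `
         {A. A \<subseteq> {..<n} \<and> card A = n - r})"

text \<open>The exponents depend on the set \<open>S\<close> only through the sequence \<open>a\<close>.\<close>

definition exponent_order_removed ::
    "('a, 'm) ring_scheme \<Rightarrow> 'a set \<Rightarrow> enat \<Rightarrow> nat \<Rightarrow> (nat \<Rightarrow> 'a) \<Rightarrow> nat \<Rightarrow> enat"
  where "exponent_order_removed D \<bb> h r a n = removed_sum D \<bb> h r a n (a n)"

definition is_order_removed_ordering ::
    "('a, 'm) ring_scheme \<Rightarrow> 'a set \<Rightarrow> 'a set \<Rightarrow> enat \<Rightarrow> nat \<Rightarrow> (nat \<Rightarrow> 'a) \<Rightarrow> bool"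
  where "is_order_removed_ordering D S \<bb> h r a \<longleftrightarrow>
    (\<forall>n. a n \<in> S) \<and>
    (\<forall>n>r. \<forall>s\<in>S. removed_sum D \<bb> h r a n (a n) \<le> removed_sum D \<bb> h r a n s)"

definition exponent_removed ::
    "('a, 'm) ring_scheme \<Rightarrow> 'a set \<Rightarrow> nat \<Rightarrow> (nat \<Rightarrow> 'a) \<Rightarrow> nat \<Rightarrow> enat"
  where "exponent_removed D \<bb> r = exponent_order_removed D \<bb> \<infinity> r"

definition is_removed_ordering ::
    "('a, 'm) ring_scheme \<Rightarrow> 'a set \<Rightarrow> 'a set \<Rightarrow> nat \<Rightarrow> (nat \<Rightarrow> 'a) \<Rightarrow> bool"
  where "is_removed_ordering D S \<bb> r = is_order_removed_ordering D S \<bb> \<infinity> r"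

definition exponent_order ::
    "('a, 'm) ring_scheme \<Rightarrow> 'a set \<Rightarrow> enat \<Rightarrow> (nat \<Rightarrow> 'a) \<Rightarrow> nat \<Rightarrow> enat"
  where "exponent_order D \<bb> h = exponent_order_removed D \<bb> h 0"

definition is_order_ordering ::
    "('a, 'm) ring_scheme \<Rightarrow> 'a set \<Rightarrow> 'a set \<Rightarrow> enat \<Rightarrow> (nat \<Rightarrow> 'a) \<Rightarrow> bool"
  where "is_order_ordering D S \<bb> h = is_order_removed_ordering D S \<bb> h 0"

lemma exponent_order_eq_sum:
  "exponent_order D \<bb> h a n = (\<Sum>i<n. min h (ideal_val D \<bb> (a n \<ominus>\<^bsub>D\<^esub> a i)))"
proof -
  have "{A. A \<subseteq> {..<n} \<and> card A = n - 0} = {{..<n}}"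
    using card_subset_eq[of "{..<n}"] by auto
  then show ?thesis
    by (simp add: exponent_order_def exponent_order_removed_def removed_sum_def)
qed

end

theory Submission
  imports Defs
begin

text \<open>
  The theorem is about ultrametrics. The powers of \<open>\<bb>\<close> form a descending chain of ideals, so
  \<open>w x y = min h (v\<^sub>\<bb> (x - y))\<close> is symmetric and satisfies
  \<open>w x z \<ge> min (w x y) (w y z)\<close> (lemma \<open>ultrametric_ideal_val\<close>). What remains
  is an argument about an arbitrary set with such a function \<open>w\<close>.

  For points \<open>b\<^sub>0, \<dots>, b\<^bsub>n-1\<^esub>\<close> let \<open>R\<^sub>b n s\<close> be the sum of the \<open>n - r\<close> smallest among the
  values \<open>w s (b\<^sub>i)\<close>. An \<open>r\<close>-removed ordering \<open>a\<close> minimises \<open>R\<^sub>a n\<close> at \<open>a\<^sub>n\<close>, and the minimum is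
  its exponent \<open>\<alpha>\<^sub>n\<close>. The point is that \<open>\<alpha>\<^sub>n\<close> is a max-min: for all points
  \<open>b\<^sub>0, \<dots>, b\<^bsub>n-1\<^esub>\<close> some \<open>a\<^sub>j\<close> with \<open>j \<le> n\<close> satisfies \<open>R\<^sub>b n (a\<^sub>j) \<le> \<alpha>\<^sub>n\<close>. When \<open>b\<close> is a second
  ordering, its \<open>n\<close>-th exponent is at most \<open>R\<^sub>b n (a\<^sub>j)\<close>, hence at most \<open>\<alpha>\<^sub>n\<close>, and the two
  exponents agree by symmetry.

  The max-min property has two halves, with the points \<open>a\<^sub>i\<close> (\<open>i \<le> n\<close>, \<open>i \<noteq> j\<close>) mediating between
  \<open>b\<close> and \<open>\<alpha>\<^sub>n\<close>. First, \<open>n + 1\<close> points against \<open>n\<close> points leave room for a matching: some \<open>a\<^sub>j\<close> is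
  at least as close to the remaining \<open>a\<^sub>i\<close> as to the \<open>b\<^sub>i\<close>, matched in a suitable way
  (\<open>dominating_matching\<close>). This is the combinatorial counterpart of Lagrange interpolation at
  \<open>a\<^sub>0, \<dots>, a\<^sub>n\<close> of the monic polynomial with roots \<open>b\<^sub>i\<close>. Second, in an ordering every \<open>j \<le> n\<close>
  has the property that the \<open>n - r\<close> smallest of the values \<open>w (a\<^sub>j) (a\<^sub>i)\<close>, with \<open>i \<le> n\<close> and
  \<open>i \<noteq> j\<close>, sum to at most \<open>\<alpha>\<^sub>n\<close> (\<open>greedy_deleted_sum_le\<close>), by induction on \<open>n\<close>.

  Orderings exist because the extended natural numbers are well-ordered, so each minimum over
  \<open>S\<close> is attained.
\<close>

section \<open>Smallest sums of a given number of terms\<close>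

definition min_subset_sum :: "'i set \<Rightarrow> nat \<Rightarrow> ('i \<Rightarrow> 'v::{linorder, ordered_comm_monoid_add}) \<Rightarrow> 'v"
  where "min_subset_sum F k f = Min (sum f ` {A. A \<subseteq> F \<and> card A = k})"

lemma min_subset_sum_le:
  assumes "finite F" "A \<subseteq> F" "card A = k"
  shows "min_subset_sum F k f \<le> sum f A"
  unfolding min_subset_sum_def using assms by (intro Min_le) auto

lemma min_subset_sum_attained:
  assumes "finite F" "k \<le> card F"
  obtains A where "A \<subseteq> F" "card A = k" "min_subset_sum F k f = sum f A"
proof -
  have "{A. A \<subseteq> F \<and> card A = k} \<noteq> {}"
    using obtain_subset_with_card_n[OF assms(2)] by auto
  then have "min_subset_sum F k f \<in> sum f ` {A. A \<subseteq> F \<and> card A = k}"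
    unfolding min_subset_sum_def using assms(1) by (intro Min_in) auto
  then show thesis using that by auto
qed

lemma min_subset_sum_cong:
  assumes "F = G" "\<And>i. i \<in> G \<Longrightarrow> f i = g i"
  shows "min_subset_sum F k f = min_subset_sum G k g"
  unfolding min_subset_sum_def using assms
  by (auto intro!: arg_cong[where f = Min] image_cong sum.cong)

lemma min_subset_sum_bij_mono:
  assumes "finite F" "k \<le> card F" "bij_betw \<phi> F G" "\<And>i. i \<in> F \<Longrightarrow> g (\<phi> i) \<le> f i"
  shows "min_subset_sum G k g \<le> min_subset_sum F k f"
proof -
  obtain A where A: "A \<subseteq> F" "card A = k" "min_subset_sum F k f = sum f A"
    using min_subset_sum_attained[OF assms(1,2)] by blast
  have inj: "inj_on \<phi> A" and sub: "\<phi> ` A \<subseteq> G"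
    using assms(3) A(1) by (auto simp: bij_betw_def intro: inj_on_subset)
  have "min_subset_sum G k g \<le> sum g (\<phi> ` A)"
    using sub A(2) inj bij_betw_finite[OF assms(3)] assms(1)
    by (intro min_subset_sum_le) (auto simp: card_image)
  also have "\<dots> = (\<Sum>i\<in>A. g (\<phi> i))" using inj by (simp add: sum.reindex)
  also have "\<dots> \<le> sum f A" using A(1) assms(4) by (intro sum_mono) auto
  finally show ?thesis using A(3) by simp
qed

text \<open>If the values on \<open>C\<close> are the largest ones, then as long as a selection contains an element
  of \<open>C\<close> and misses one outside \<open>C\<close>, trading the former for the latter does not increase the sum.
  When no trade is left, the selection avoids \<open>C\<close> or contains everything outside it.\<close>

lemma exchange_at_threshold:
  fixes f :: "'i \<Rightarrow> 'v::{linorder, ordered_comm_monoid_add}"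
  assumes "finite F" "A \<subseteq> F" "\<And>x y. x \<in> F - C \<Longrightarrow> y \<in> C \<Longrightarrow> f x \<le> f y"
  obtains B where "B \<subseteq> F" "card B = card A" "sum f B \<le> sum f A" "B \<inter> C = {} \<or> F - C \<subseteq> B"
proof -
  have "\<exists>B\<subseteq>F. card B = card A \<and> sum f B \<le> sum f A \<and> (B \<inter> C = {} \<or> F - C \<subseteq> B)"
    using assms(2)
  proof (induction "card (A \<inter> C)" arbitrary: A rule: less_induct)
    case less
    show ?case
    proof (cases "A \<inter> C = {} \<or> F - C \<subseteq> A")
      case True
      then show ?thesis using less.prems by blast
    next
      case False
      then obtain y x where y: "y \<in> A" "y \<in> C" and x: "x \<in> F - C" "x \<notin> A" by blast
      let ?A = "insert x (A - {y})"
      have fin: "finite A" by (rule finite_subset[OF less.prems assms(1)])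
      have "?A \<inter> C = A \<inter> C - {y}" using x by auto
      then have "card (?A \<inter> C) < card (A \<inter> C)"
        using fin y card_Diff1_less[of "A \<inter> C" y] by simp
      moreover have "?A \<subseteq> F" using less.prems x by auto
      ultimately obtain B where B: "B \<subseteq> F" "card B = card ?A" "sum f B \<le> sum f ?A"
          "B \<inter> C = {} \<or> F - C \<subseteq> B"
        using less.hyps[of ?A] by auto
      have "card ?A = card A" using fin x card_Suc_Diff1[OF fin y(1)] by simp
      moreover have "sum f ?A = f x + sum f (A - {y})" using fin x by simp
      moreover have "sum f A = f y + sum f (A - {y})" by (rule sum.remove[OF fin y(1)])
      moreover have "f x \<le> f y" using assms(3) x y by blast
      ultimately show ?thesis
        using B by (metis add_right_mono order_trans)
    qed
  qed
  then show thesis using that by blast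
qed

section \<open>Orderings in an ultrametric set\<close>

text \<open>The function \<open>w\<close> measures closeness, so that the ultrametric inequality bounds it from
  below. It is the order-reversed form of an ultrametric distance.\<close>

locale ultrametric_closeness =
  fixes M :: "'p set" and w :: "'p \<Rightarrow> 'p \<Rightarrow> 'v::{linorder, ordered_comm_monoid_add}"
  assumes sym: "\<And>x y. x \<in> M \<Longrightarrow> y \<in> M \<Longrightarrow> w x y = w y x"
    and ultra: "\<And>x y z. x \<in> M \<Longrightarrow> y \<in> M \<Longrightarrow> z \<in> M \<Longrightarrow> min (w x y) (w y z) \<le> w x z"
begin

text \<open>The matching is greedy: match a closest pair \<open>a\<^sub>p\<close>, \<open>b\<^sub>q\<close>, delete it, and continue with the
  rest until a single index \<open>j\<close> is left. Since \<open>w (a\<^sub>j) (b\<^sub>q) \<le> w (a\<^sub>p) (b\<^sub>q)\<close> by the choice of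
  the pair, the ultrametric inequality through \<open>b\<^sub>q\<close> gives \<open>w (a\<^sub>j) (b\<^sub>q) \<le> w (a\<^sub>j) (a\<^sub>p)\<close>.\<close>

lemma dominating_matching:
  assumes "finite F" "finite G" "card F = Suc (card G)"
    and "\<And>i. i \<in> F \<Longrightarrow> a i \<in> M" "\<And>i. i \<in> G \<Longrightarrow> b i \<in> M"
  obtains j \<phi> where "j \<in> F" "bij_betw \<phi> (F - {j}) G"
    "\<And>i. i \<in> F - {j} \<Longrightarrow> w (a j) (b (\<phi> i)) \<le> w (a j) (a i)"
proof -
  have "\<exists>j \<phi>. j \<in> F \<and> bij_betw \<phi> (F - {j}) G \<and>
      (\<forall>i \<in> F - {j}. w (a j) (b (\<phi> i)) \<le> w (a j) (a i))"
    using assms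
  proof (induction "card G" arbitrary: F G)
    case 0
    then obtain j where "F = {j}" by (metis One_nat_def card_1_singletonE)
    moreover have "G = {}" using 0 by simp
    ultimately show ?case by (auto simp: bij_betw_def)
  next
    case (Suc n)
    have "F \<times> G \<noteq> {}" "finite (F \<times> G)" using Suc.prems Suc.hyps(2) by auto
    then have "Max ((\<lambda>(i, k). w (a i) (b k)) ` (F \<times> G)) \<in> (\<lambda>(i, k). w (a i) (b k)) ` (F \<times> G)"
      by (intro Max_in) auto
    then obtain p q where pq: "p \<in> F" "q \<in> G"
      and pq_Max: "w (a p) (b q) = Max ((\<lambda>(i, k). w (a i) (b k)) ` (F \<times> G))" by auto
    have max: "w (a i) (b k) \<le> w (a p) (b q)" if "i \<in> F" "k \<in> G" for i k
      unfolding pq_Max using that \<open>finite (F \<times> G)\<close> by (intro Max_ge) auto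
    have "\<exists>j \<phi>. j \<in> F - {p} \<and> bij_betw \<phi> (F - {p} - {j}) (G - {q}) \<and>
        (\<forall>i \<in> F - {p} - {j}. w (a j) (b (\<phi> i)) \<le> w (a j) (a i))"
      using Suc.prems Suc.hyps(2) pq by (intro Suc.hyps(1)) auto
    then obtain j \<phi> where j: "j \<in> F" "j \<noteq> p" and \<phi>: "bij_betw \<phi> (F - {p} - {j}) (G - {q})"
      and le: "\<And>i. i \<in> F - {p} - {j} \<Longrightarrow> w (a j) (b (\<phi> i)) \<le> w (a j) (a i)" by auto
    have "min (w (a j) (b q)) (w (b q) (a p)) \<le> w (a j) (a p)"
      using Suc.prems j pq by (intro ultra) auto
    moreover have "w (b q) (a p) = w (a p) (b q)" using Suc.prems pq by (intro sym) auto
    ultimately have new: "w (a j) (b q) \<le> w (a j) (a p)"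
      using max[OF j(1) pq(2)] by (simp add: min_def split: if_splits)
    have "bij_betw (\<phi>(p := q)) (insert p (F - {p} - {j})) (insert q (G - {q}))"
      using bij_betw_cong[of "F - {p} - {j}" "\<phi>(p := q)" \<phi>] \<phi>
        notIn_Un_bij_betw[of p "F - {p} - {j}" "\<phi>(p := q)" "G - {q}"] by simp
    moreover have "insert p (F - {p} - {j}) = F - {j}" "insert q (G - {q}) = G"
      using pq j by auto
    ultimately have "bij_betw (\<phi>(p := q)) (F - {j}) G" by simp
    moreover have "\<forall>i \<in> F - {j}. w (a j) (b ((\<phi>(p := q)) i)) \<le> w (a j) (a i)"
      using new le by auto
    ultimately show ?case using j(1) by blast
  qed
  then show thesis using that by blast
qed

definition removed :: "nat \<Rightarrow> (nat \<Rightarrow> 'p) \<Rightarrow> nat \<Rightarrow> 'p \<Rightarrow> 'v"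
  where "removed r a n s = min_subset_sum {..<n} (n - r) (\<lambda>i. w s (a i))"

lemma removed_cong:
  "(\<And>i. i < n \<Longrightarrow> a i = b i) \<Longrightarrow> removed r a n s = removed r b n s"
  unfolding removed_def by (intro min_subset_sum_cong) auto

lemma removed_eq_0: "n \<le> r \<Longrightarrow> removed r a n s = 0"
proof -
  assume "n \<le> r"
  then have "{A. A \<subseteq> {..<n} \<and> card A = n - r} = {{}}"
    using finite_subset[OF _ finite_lessThan] by auto
  then show ?thesis by (simp add: removed_def min_subset_sum_def)
qed

definition greedy :: "nat \<Rightarrow> (nat \<Rightarrow> 'p) \<Rightarrow> bool"
  where "greedy r a \<longleftrightarrow>
    (\<forall>n. a n \<in> M) \<and> (\<forall>n. \<forall>s\<in>M. removed r a n (a n) \<le> removed r a n s)"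

text \<open>Let \<open>m = w (a\<^sub>j) (a\<^sub>n)\<close>, let \<open>C\<close> be the set of indices \<open>i < n\<close> with \<open>w (a\<^sub>n) (a\<^sub>i) \<ge> m\<close> and
  let \<open>l\<close> be its largest element; it exists because \<open>j \<in> C\<close>. At indices outside \<open>C\<close> the points
  \<open>a\<^sub>j\<close> and \<open>a\<^sub>n\<close> see the same values, all below \<open>m\<close>. So if an optimal selection for \<open>\<alpha>\<^sub>n\<close> avoids
  \<open>C\<close>, it serves for \<open>a\<^sub>j\<close> as well. Otherwise it may be taken to contain everything outside \<open>C\<close>, in
  particular all indices beyond \<open>l\<close>. Split off one selected element of \<open>C\<close>, which is \<open>l\<close> if \<open>l\<close> is selected:
  it costs at least \<open>m\<close>, which pays for the index \<open>n\<close>. The rest below \<open>l\<close> costs at least \<open>R l (a\<^sub>n)\<close>, which is at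
  least \<open>R l (a\<^sub>l)\<close> because \<open>a\<^sub>l\<close> was chosen when \<open>a\<^sub>n\<close> was available, and the induction
  hypothesis at \<open>l\<close> applies.\<close>

lemma greedy_deleted_sum_le:
  assumes "greedy r a" "j \<le> n"
  shows "min_subset_sum ({..n} - {j}) (n - r) (\<lambda>i. w (a j) (a i)) \<le> removed r a n (a n)"
  using assms(2)
proof (induction n rule: less_induct)
  case (less n)
  have M: "a i \<in> M" for i using assms(1) by (simp add: greedy_def)
  show ?case
  proof (cases "j = n")
    case True
    then have "{..n} - {j} = {..<n}" by auto
    then show ?thesis using True by (simp add: removed_def)
  next
    case False
    with less.prems have jn: "j < n" by simp
    define m where "m = w (a j) (a n)"
    define C where "C = {i. i < n \<and> m \<le> w (a n) (a i)}"
    define l where "l = Max C"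
    have "j \<in> C" using jn sym[OF M M] by (simp add: C_def m_def)
    have finC: "finite C" by (simp add: C_def)
    have lC: "l \<in> C" unfolding l_def using finC \<open>j \<in> C\<close> by (intro Max_in) auto
    have Cl: "i \<le> l" if "i \<in> C" for i unfolding l_def using finC that by simp
    have jl: "j \<le> l" using Cl \<open>j \<in> C\<close> .
    have ln: "l < n" using lC by (simp add: C_def)
    have outside: "w (a j) (a i) \<le> w (a n) (a i)" if "i < n" "i \<notin> C" for i
    proof (rule ccontr)
      assume "\<not> ?thesis"
      moreover have "min (w (a n) (a j)) (w (a j) (a i)) \<le> w (a n) (a i)"
        by (intro ultra M)
      moreover have "w (a n) (a j) = m" unfolding m_def by (intro sym M)
      moreover have "w (a n) (a i) < m" using that by (auto simp: C_def)
      ultimately show False by (auto simp: min_def split: if_splits)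
    qed
    obtain A0 where A0: "A0 \<subseteq> {..<n}" "card A0 = n - r"
        "removed r a n (a n) = (\<Sum>i\<in>A0. w (a n) (a i))"
      using min_subset_sum_attained[of "{..<n}" "n - r" "\<lambda>i. w (a n) (a i)"]
      unfolding removed_def by auto
    obtain A where A: "A \<subseteq> {..<n}" "card A = n - r"
        and sumA: "(\<Sum>i\<in>A. w (a n) (a i)) \<le> removed r a n (a n)"
        and alt: "A \<inter> C = {} \<or> {..<n} - C \<subseteq> A"
    proof (rule exchange_at_threshold[of "{..<n}" A0 C "\<lambda>i. w (a n) (a i)"])
      show "w (a n) (a x) \<le> w (a n) (a y)" if "x \<in> {..<n} - C" "y \<in> C" for x y
        using that by (auto simp: C_def)
    qed (use A0 that in auto)
    have finA: "finite A" by (rule finite_subset[OF A(1)]) simp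
    show ?thesis
    proof (cases "A \<inter> C = {}")
      case True
      have "min_subset_sum ({..n} - {j}) (n - r) (\<lambda>i. w (a j) (a i)) \<le> (\<Sum>i\<in>A. w (a j) (a i))"
        using A True \<open>j \<in> C\<close> by (intro min_subset_sum_le) auto
      also have "\<dots> \<le> (\<Sum>i\<in>A. w (a n) (a i))"
        using A(1) True by (intro sum_mono outside) auto
      finally show ?thesis using sumA by simp
    next
      case False
      with alt have rest: "{..<n} - C \<subseteq> A" by simp
      \<comment> \<open>Taking \<open>l\<close> itself when possible leaves, up to \<open>l\<close>, only indices below \<open>l\<close>, where
        minimality of \<open>a\<^sub>l\<close> can be used.\<close>
      obtain c where c: "c \<in> A" "c \<in> C" "l \<in> A \<Longrightarrow> c = l"
        using False lC by (cases "l \<in> A") auto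
      define E where "E = A \<inter> {..<l} - {c}"
      have beyond: "{l<..<n} \<subseteq> A" using rest Cl by fastforce
      have split: "A = insert c (E \<union> {l<..<n})"
      proof
        show "A \<subseteq> insert c (E \<union> {l<..<n})"
        proof
          fix i assume "i \<in> A"
          then show "i \<in> insert c (E \<union> {l<..<n})"
            using A(1) c(3) by (cases i l rule: linorder_cases) (auto simp: E_def)
        qed
        show "insert c (E \<union> {l<..<n}) \<subseteq> A" using c(1) beyond by (auto simp: E_def)
      qed
      have finE: "finite E" using finA by (simp add: E_def)
      have cnew: "c \<notin> E \<union> {l<..<n}" using Cl[OF c(2)] by (auto simp: E_def)
      have disj: "E \<inter> {l<..<n} = {}" by (auto simp: E_def)
      have "n - r = Suc (card E + (n - l - 1))"
        unfolding A(2)[symmetric] using finE cnew disj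
        by (subst split) (simp add: card_Un_disjoint)
      then have cardE: "card E = l - r" and rl: "n - r = Suc (l - r + (n - l - 1))"
        using ln by auto
      obtain E' where E': "E' \<subseteq> {..l} - {j}" "card E' = l - r"
          "min_subset_sum ({..l} - {j}) (l - r) (\<lambda>i. w (a j) (a i)) = (\<Sum>i\<in>E'. w (a j) (a i))"
        using min_subset_sum_attained[of "{..l} - {j}" "l - r" "\<lambda>i. w (a j) (a i)"] jl by auto
      have finE': "finite E'" by (rule finite_subset[OF E'(1)]) simp
      have disj': "E' \<inter> {l<..<n} = {}" "n \<notin> E' \<union> {l<..<n}" using E'(1) ln by auto
      have "(\<Sum>i\<in>E'. w (a j) (a i)) \<le> removed r a l (a l)"
        using less.IH[OF ln jl] E'(3) by simp
      also have "\<dots> \<le> removed r a l (a n)" using assms(1) M by (simp add: greedy_def)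
      also have "\<dots> \<le> (\<Sum>i\<in>E. w (a n) (a i))"
        unfolding removed_def using cardE by (intro min_subset_sum_le) (auto simp: E_def)
      finally have below: "(\<Sum>i\<in>E'. w (a j) (a i)) \<le> (\<Sum>i\<in>E. w (a n) (a i))" .
      have above: "(\<Sum>i\<in>{l<..<n}. w (a j) (a i)) \<le> (\<Sum>i\<in>{l<..<n}. w (a n) (a i))"
        using Cl by (intro sum_mono outside) fastforce+
      have "min_subset_sum ({..n} - {j}) (n - r) (\<lambda>i. w (a j) (a i))
          \<le> (\<Sum>i\<in>insert n (E' \<union> {l<..<n}). w (a j) (a i))"
      proof (intro min_subset_sum_le)
        show "insert n (E' \<union> {l<..<n}) \<subseteq> {..n} - {j}" using E'(1) jn jl ln by auto
        show "card (insert n (E' \<union> {l<..<n})) = n - r"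
          using finE' disj' E'(2) rl by (simp add: card_Un_disjoint)
      qed auto
      also have "\<dots> = m + ((\<Sum>i\<in>E'. w (a j) (a i)) + (\<Sum>i\<in>{l<..<n}. w (a j) (a i)))"
        using finE' disj' by (simp add: sum.union_disjoint m_def)
      also have "\<dots> \<le> w (a n) (a c) + ((\<Sum>i\<in>E. w (a n) (a i)) + (\<Sum>i\<in>{l<..<n}. w (a n) (a i)))"
        using c(2) below above by (intro add_mono) (auto simp: C_def)
      also have "\<dots> = (\<Sum>i\<in>A. w (a n) (a i))"
        using finE cnew disj by (subst split) (simp add: sum.union_disjoint)
      finally show ?thesis using sumA by simp
    qed
  qed
qed

text \<open>The max-min property of the exponents: the matching bounds the removed sum of \<open>a\<^sub>j\<close> against
  \<open>b\<close> by the one against the \<open>a\<^sub>i\<close> with \<open>i \<le> n\<close>, \<open>i \<noteq> j\<close>, which the exponent of \<open>a\<close> bounds in turn.\<close>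

lemma greedy_exponent_max_min:
  assumes "greedy r a" "\<And>i. i < n \<Longrightarrow> b i \<in> M"
  obtains j where "j \<le> n" "removed r b n (a j) \<le> removed r a n (a n)"
proof -
  obtain j \<phi> where j: "j \<in> {..n}" and \<phi>: "bij_betw \<phi> ({..n} - {j}) {..<n}"
    and le: "\<And>i. i \<in> {..n} - {j} \<Longrightarrow> w (a j) (b (\<phi> i)) \<le> w (a j) (a i)"
  proof (rule dominating_matching[of "{..n}" "{..<n}" a b])
    show "a i \<in> M" for i using assms(1) by (simp add: greedy_def)
  qed (use assms(2) that in auto)
  have "removed r b n (a j) \<le> min_subset_sum ({..n} - {j}) (n - r) (\<lambda>i. w (a j) (a i))"
    unfolding removed_def using j \<phi> le by (intro min_subset_sum_bij_mono[OF _ _ \<phi>]) auto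
  also have "\<dots> \<le> removed r a n (a n)" using j by (intro greedy_deleted_sum_le[OF assms(1)]) auto
  finally show thesis using that j by simp
qed

lemma greedy_exponent_unique:
  assumes "greedy r a" "greedy r a'"
  shows "removed r a n (a n) = removed r a' n (a' n)"
proof -
  have "removed r b n (b n) \<le> removed r c n (c n)" if b: "greedy r b" and c: "greedy r c" for b c
  proof -
    have "b i \<in> M" for i using b by (simp add: greedy_def)
    then obtain j where "removed r b n (c j) \<le> removed r c n (c n)"
      using greedy_exponent_max_min[OF c, of n b] by metis
    moreover have "removed r b n (b n) \<le> removed r b n (c j)"
      using b c by (simp add: greedy_def)
    ultimately show ?thesis by simp
  qed
  then show ?thesis using assms by (meson order_antisym)
qed

text \<open>The values of \<open>w\<close> lie in a linear order, where an infimum over infinitely many points need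
  not be attained; well-ordering of the values supplies the minimum at each step.\<close>

lemma greedy_exists:
  assumes "M \<noteq> {}" and wo: "\<And>V::'v set. V \<noteq> {} \<Longrightarrow> \<exists>v\<in>V. \<forall>u\<in>V. v \<le> u"
  shows "\<exists>a. greedy r a"
proof -
  have "\<exists>a. \<forall>n. a n \<in> M \<and> (\<forall>s\<in>M. removed r a n (a n) \<le> removed r a n s)"
  proof (rule dependent_wellorder_choice)
    fix s and f g :: "nat \<Rightarrow> 'p" and n :: nat
    assume "\<And>y. y < n \<Longrightarrow> f y = g y"
    then have "removed r f n = removed r g n" by (intro ext removed_cong)
    then show "(s \<in> M \<and> (\<forall>t\<in>M. removed r f n s \<le> removed r f n t)) =
        (s \<in> M \<and> (\<forall>t\<in>M. removed r g n s \<le> removed r g n t))" by simp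
  next
    fix n :: nat and f :: "nat \<Rightarrow> 'p"
    show "\<exists>s. s \<in> M \<and> (\<forall>t\<in>M. removed r f n s \<le> removed r f n t)"
      using wo[of "removed r f n ` M"] assms(1) by auto
  qed
  then show ?thesis by (auto simp: greedy_def)
qed

end

section \<open>The valuation attached to an ideal\<close>

lemma (in cring) ideal_power:
  assumes "ideal I R"
  shows "ideal (I [^]\<^bsub>ideals_set R\<^esub> (k::nat)) R"
    and "I [^]\<^bsub>ideals_set R\<^esub> Suc k \<subseteq> I [^]\<^bsub>ideals_set R\<^esub> k"
proof -
  show pow: "ideal (I [^]\<^bsub>ideals_set R\<^esub> k) R" for k :: nat
    by (induction k) (simp_all add: ideals_set_def nat_pow_def oneideal ideal_prod_is_ideal assms)
  show "I [^]\<^bsub>ideals_set R\<^esub> Suc k \<subseteq> I [^]\<^bsub>ideals_set R\<^esub> k"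
    using ideal_prod_inter[OF pow assms, of k] by (simp add: ideals_set_def nat_pow_def)
qed

text \<open>Membership in the powers replaces containment of principal ideals, so that closure of ideals
  under sums and negatives applies directly.\<close>

lemma (in cring) ideal_val_eq:
  assumes "ideal I R" "x \<in> carrier R"
  shows "ideal_val R I x = (SUP k \<in> {k. x \<in> I [^]\<^bsub>ideals_set R\<^esub> k}. enat k)"
  unfolding ideal_val_def
proof -
  have "PIdl x \<subseteq> I [^]\<^bsub>ideals_set R\<^esub> k \<longleftrightarrow> x \<in> I [^]\<^bsub>ideals_set R\<^esub> k" for k :: nat
    using cgenideal_minimal[OF ideal_power(1)[OF assms(1)]] cgenideal_self[OF assms(2)] by blast
  then show "(SUP k \<in> {k. PIdl x \<subseteq> I [^]\<^bsub>ideals_set R\<^esub> k}. enat k) =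
      (SUP k \<in> {k. x \<in> I [^]\<^bsub>ideals_set R\<^esub> k}. enat k)" by simp
qed

lemma (in cring) ideal_val_add:
  assumes "ideal I R" "x \<in> carrier R" "y \<in> carrier R"
  shows "min (ideal_val R I x) (ideal_val R I y) \<le> ideal_val R I (x \<oplus> y)"
proof -
  let ?P = "\<lambda>k. I [^]\<^bsub>ideals_set R\<^esub> (k::nat)"
  have dec: "?P l \<subseteq> ?P k" if "k \<le> l" for k l
    using lift_Suc_antimono_le[of ?P, OF ideal_power(2)[OF assms(1)] that] .
  have "enat (min k l) \<le> (SUP k \<in> {k. x \<oplus> y \<in> ?P k}. enat k)" if "x \<in> ?P k" "y \<in> ?P l" for k l
  proof -
    have "x \<in> ?P (min k l)" "y \<in> ?P (min k l)"
      using that dec[of "min k l" k] dec[of "min k l" l] by auto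
    then have "x \<oplus> y \<in> ?P (min k l)"
      using ideal_power(1)[OF assms(1)] by (meson additive_subgroup.a_closed ideal.axioms(1))
    then show ?thesis by (intro SUP_upper) simp
  qed
  then show ?thesis
    using assms by (simp add: ideal_val_eq inf_min[symmetric] SUP_inf_distrib2 SUP_le_iff)
       (simp add: inf_min)
qed

lemma (in cring) ideal_val_minus:
  assumes "ideal I R" "x \<in> carrier R"
  shows "ideal_val R I (\<ominus> x) = ideal_val R I x"
proof -
  have "\<ominus> x \<in> I [^]\<^bsub>ideals_set R\<^esub> k \<longleftrightarrow> x \<in> I [^]\<^bsub>ideals_set R\<^esub> k" for k :: nat
    using ideal_power(1)[OF assms(1)] assms(2)
    by (metis additive_subgroup.a_inv_closed ideal.axioms(1) minus_minus)
  then show ?thesis using assms by (simp add: ideal_val_eq)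
qed

lemma (in cring) ultrametric_ideal_val:
  assumes "ideal I R" "S \<subseteq> carrier R"
  shows "ultrametric_closeness S (\<lambda>x y. min h (ideal_val R I (x \<ominus> y)))"
proof
  fix x y assume "x \<in> S" "y \<in> S"
  then have xy: "x \<in> carrier R" "y \<in> carrier R" using assms(2) by auto
  then have "y \<ominus> x = \<ominus> (x \<ominus> y)" by algebra
  then show "min h (ideal_val R I (x \<ominus> y)) = min h (ideal_val R I (y \<ominus> x))"
    using ideal_val_minus[OF assms(1), of "x \<ominus> y"] xy by simp
next
  fix x y z assume "x \<in> S" "y \<in> S" "z \<in> S"
  then have xyz: "x \<in> carrier R" "y \<in> carrier R" "z \<in> carrier R" using assms(2) by auto
  then have "(x \<ominus> y) \<oplus> (y \<ominus> z) = x \<ominus> z" by algebra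
  then have "min (ideal_val R I (x \<ominus> y)) (ideal_val R I (y \<ominus> z)) \<le> ideal_val R I (x \<ominus> z)"
    using ideal_val_add[OF assms(1), of "x \<ominus> y" "y \<ominus> z"] xyz by simp
  then show "min (min h (ideal_val R I (x \<ominus> y))) (min h (ideal_val R I (y \<ominus> z)))
      \<le> min h (ideal_val R I (x \<ominus> z))"
    by (auto simp: min_def split: if_splits)
qed

section \<open>Removed orderings and their exponents\<close>

theorem theorem3p6:
  fixes D :: "('a, 'm) ring_scheme" and S \<bb> :: "'a set"
  assumes "dedekind_domain D"
    and "S \<subseteq> carrier D" and "S \<noteq> {}"
    and "ideal \<bb> D"
  shows
    "(\<forall>r::nat.
        (\<forall>a a'. is_removed_ordering D S \<bb> r a \<longrightarrow> is_removed_ordering D S \<bb> r a' \<longrightarrow>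
           (\<forall>k. exponent_removed D \<bb> r a k = exponent_removed D \<bb> r a' k)) \<and>
        (\<exists>!e. \<exists>a. is_removed_ordering D S \<bb> r a \<and> (\<forall>k. exponent_removed D \<bb> r a k = e k)))
   \<and> (\<forall>h::enat.
        (\<forall>a a'. is_order_ordering D S \<bb> h a \<longrightarrow> is_order_ordering D S \<bb> h a' \<longrightarrow>
           (\<forall>k. exponent_order D \<bb> h a k = exponent_order D \<bb> h a' k)) \<and>
        (\<exists>!e. \<exists>a. is_order_ordering D S \<bb> h a \<and> (\<forall>k. exponent_order D \<bb> h a k = e k)))
   \<and> (\<forall>(h::enat) (r::nat).
        (\<forall>a a'. is_order_removed_ordering D S \<bb> h r a \<longrightarrow>
                is_order_removed_ordering D S \<bb> h r a' \<longrightarrow>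
           (\<forall>k. exponent_order_removed D \<bb> h r a k = exponent_order_removed D \<bb> h r a' k)) \<and>
        (\<exists>!e. \<exists>a. is_order_removed_ordering D S \<bb> h r a \<and>
                  (\<forall>k. exponent_order_removed D \<bb> h r a k = e k)))"
proof -
  interpret dedekind_domain D by fact
  have general:
    "(\<forall>a a'. is_order_removed_ordering D S \<bb> h r a \<longrightarrow> is_order_removed_ordering D S \<bb> h r a' \<longrightarrow>
        (\<forall>k. exponent_order_removed D \<bb> h r a k = exponent_order_removed D \<bb> h r a' k)) \<and>
     (\<exists>!e. \<exists>a. is_order_removed_ordering D S \<bb> h r a \<and>
        (\<forall>k. exponent_order_removed D \<bb> h r a k = e k))" for h r
  proof -
    interpret ultrametric_closeness S "\<lambda>x y. min h (ideal_val D \<bb> (x \<ominus>\<^bsub>D\<^esub> y))"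
      using ultrametric_ideal_val assms(2,4) by blast
    have removed: "removed_sum D \<bb> h r a n s = removed r a n s" for a n s
      by (simp add: removed_sum_def removed_def min_subset_sum_def)
    \<comment> \<open>Minimality at \<open>n \<le> r\<close> is automatic, since all sums are then empty.\<close>
    have ordering: "is_order_removed_ordering D S \<bb> h r a \<longleftrightarrow> greedy r a" for a
      unfolding is_order_removed_ordering_def greedy_def removed
      by (metis order_refl not_le removed_eq_0)
    have exponent: "exponent_order_removed D \<bb> h r a n = removed r a n (a n)" for a n
      by (simp add: exponent_order_removed_def removed)
    have "\<exists>v\<in>V. \<forall>u\<in>V. v \<le> u" if "V \<noteq> {}" for V :: "enat set"
      using that by (intro bexI[of _ "LEAST v. v \<in> V"]) (auto intro: Least_le LeastI)
    then have "\<exists>a. greedy r a" by (rule greedy_exists[OF assms(3)])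
    then obtain a where a: "greedy r a" ..
    have unique: "removed r b n (b n) = removed r c n (c n)" if "greedy r b" "greedy r c" for b c n
      using greedy_exponent_unique that .
    have "\<exists>!e. \<exists>b. greedy r b \<and> (\<forall>n. removed r b n (b n) = e n)"
    proof (rule ex1I[of _ "\<lambda>n. removed r a n (a n)"])
      show "\<exists>b. greedy r b \<and> (\<forall>n. removed r b n (b n) = removed r a n (a n))"
        by (intro exI[of _ a]) (simp add: a)
    next
      fix e assume "\<exists>b. greedy r b \<and> (\<forall>n. removed r b n (b n) = e n)"
      then obtain b where "greedy r b" "\<And>n. removed r b n (b n) = e n" by auto
      then show "e = (\<lambda>n. removed r a n (a n))" using unique[OF a] by (intro ext) simp
    qed
    then show ?thesis unfolding ordering exponent by (intro conjI allI impI unique)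
  qed
  from general[THEN conjunct1, THEN spec, THEN spec] general[THEN conjunct2]
  show ?thesis
    unfolding is_removed_ordering_def exponent_removed_def is_order_ordering_def exponent_order_def
    by (intro conjI allI)
qed

end
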